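(* Let $\mathcal{H}$ be a finite dimensional complex Hilbert space, let $A$ be any linear operator on $\mathcal{H}$ (not assumed positive or self-adjoint), let $d, m\geq 1$ be integers, and let $\mathbf{T}=[T_1,\ldots,T_d]$ be an $(A,m)$-isometric $d$-tuple of commuting operators on $\mathcal{H}$. Then there exist a spherical $A$-isometric tuple $\mathbf{S}=[S_1,\ldots,S_d]$ and a nilpotent tuple $\mathbf{N}=[N_1,\ldots,N_d]$ of operators on $\mathcal{H}$ such that $\mathbf{N}$ commutes with $\mathbf{S}$ and $\mathbf{T}=\mathbf{S}+\mathbf{N}$, i.e. $T_j=S_j+N_j$ for all $1\leq j\leq d$.
   Context: For a commuting tuple $\mathbf{T}=[T_1,\ldots,T_d]$ and a multiindex $\alpha=(\alpha_1,\ldots,\alpha_d)$ of non-negative integers, write $\mathbf{T}^{\alpha}=T_1^{\alpha_1}\cdots T_d^{\alpha_d}$, $|\alpha|=\alpha_1+\cdots+\alpha_d$, $\alpha!=\alpha_1!\cdots\alpha_d!$. Let $A$ be a bounded operator. A commuting tuple $\mathbf{T}$ is $(A,m)$-isometric if $$\sum_{k=0}^{m}(-1)^{m-k}\binom{m}{k}\sum_{|\alpha|=k}\frac{k!}{\alpha!}(\mathbf{T}^{\alpha})^{*}A\mathbf{T}^{\alpha}=0.$$ A spherical $A$-isometric tuple is an $(A,1)$-isometric tuple, i.e. a commuting tuple $\mathbf{S}$ with $S_1^{*}AS_1+\cdots+S_d^{*}AS_d=A$. A nilpotent tuple is a commuting tuple $\mathbf{N}$ for which there is a positive integer $n$ with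 $\mathbf{N}^{\alpha}=0$ for all $|\alpha|=n$ (equivalently, each $N_j$ is nilpotent). The tuple $\mathbf{N}$ commutes with $\mathbf{S}$ if $S_jN_k=N_kS_j$ for all $j,k$. *)

theory Defs
  imports Complex_Main
begin

section \<open>Finite-dimensional complex Hilbert spaces\<close>

text \<open>The inner product is linear in the first and conjugate-linear in the second argument.\<close>

class complex_inner = ab_group_add +
  fixes scaleC :: "complex \<Rightarrow> 'a \<Rightarrow> 'a" (infixr "*\<^sub>C" 75)
    and cinner :: "'a \<Rightarrow> 'a \<Rightarrow> complex"
  assumes scaleC_add_right: "a *\<^sub>C (x + y) = a *\<^sub>C x + a *\<^sub>C y"
    and scaleC_add_left: "(a + b) *\<^sub>C x = a *\<^sub>C x + b *\<^sub>C x"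
    and scaleC_scaleC: "a *\<^sub>C (b *\<^sub>C x) = (a * b) *\<^sub>C x"
    and scaleC_one: "1 *\<^sub>C x = x"
    and cinner_commute: "cinner x y = cnj (cinner y x)"
    and cinner_add_left: "cinner (x + y) z = cinner x z + cinner y z"
    and cinner_scaleC_left: "cinner (a *\<^sub>C x) y = a * cinner x y"
    and cinner_ge_zero: "0 \<le> Re (cinner x x)"
    and cinner_eq_zero_iff: "cinner x x = 0 \<longleftrightarrow> x = 0"

global_interpretation complex_vector:
  vector_space "scaleC :: complex \<Rightarrow> 'a \<Rightarrow> 'a::complex_inner"
  by unfold_locales
    (rule scaleC_add_right scaleC_add_left scaleC_scaleC scaleC_one)+

abbreviation cspan :: "'a::complex_inner set \<Rightarrow> 'a set"
  where "cspan \<equiv> module.span scaleC"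

abbreviation clinear :: "('a::complex_inner \<Rightarrow> 'b::complex_inner) \<Rightarrow> bool"
  where "clinear \<equiv> Vector_Spaces.linear scaleC scaleC"

text \<open>Completeness is not required separately: it is automatic in finite dimension.\<close>

class finite_dim_hilbert = complex_inner +
  assumes finitely_spanned: "\<exists>B. finite B \<and> (\<forall>x. \<exists>c. x = sum (\<lambda>b. c b *\<^sub>C b) B)"

lemma finite_cspan: "\<exists>B::'a::finite_dim_hilbert set. finite B \<and> cspan B = UNIV"
proof -
  obtain B :: "'a set" where B: "finite B" "\<And>x. \<exists>c. x = (\<Sum>b\<in>B. c b *\<^sub>C b)"
    using finitely_spanned by blast
  have "x \<in> cspan B" for x
    using B(2)[of x] by (auto intro!: complex_vector.span_sum complex_vector.span_scale
        intro: complex_vector.span_base)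
  with B(1) show ?thesis by blast
qed

lemma clinearI:
  assumes "\<And>x y. f (x + y) = f x + f y" "\<And>a x. f (a *\<^sub>C x) = a *\<^sub>C f x"
  shows "clinear f"
  using assms unfolding Vector_Spaces.linear_iff
  by (auto intro: complex_vector.vector_space_axioms)

lemma clinear_add: "clinear f \<Longrightarrow> f (x + y) = f x + f y"
  and clinear_scaleC: "clinear f \<Longrightarrow> f (a *\<^sub>C x) = a *\<^sub>C f x"
  unfolding Vector_Spaces.linear_iff by auto

lemma cinner_add_right: "cinner x (y + z) = cinner x y + cinner (x::'a::complex_inner) z"
  by (metis cinner_add_left cinner_commute complex_cnj_add)

lemma cinner_scaleC_right: "cinner x (a *\<^sub>C y) = cnj a * cinner (x::'a::complex_inner) y"
  by (metis cinner_scaleC_left cinner_commute complex_cnj_mult)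

lemma cinner_zero_left [simp]: "cinner 0 (x::'a::complex_inner) = 0"
  using cinner_add_left[of 0 0 x] by simp

lemma cinner_zero_right [simp]: "cinner (x::'a::complex_inner) 0 = 0"
  using cinner_add_right[of x 0 0] by simp

lemma cinner_diff_left: "cinner (x - y) z = cinner x z - cinner (y::'a::complex_inner) z"
  using cinner_add_left[of "x - y" y z] by simp

lemma cinner_diff_right: "cinner x (y - z) = cinner x y - cinner (x::'a::complex_inner) z"
  using cinner_add_right[of x "y - z" z] by simp

lemma cinner_ext_right:
  assumes "\<And>x. cinner x y = cinner (x::'a::complex_inner) z"
  shows "y = z"
  using assms[of "y - z"] cinner_diff_right[of "y - z" y z] cinner_eq_zero_iff[of "y - z"] by simp

section \<open>Adjoints\<close>

definition adjoint_op :: "('a::complex_inner \<Rightarrow> 'a) \<Rightarrow> 'a \<Rightarrow> 'a"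
  where "adjoint_op T = (THE T'. \<forall>x y. cinner (T x) y = cinner x (T' y))"

lemma riesz_span:
  fixes f :: "'a::complex_inner \<Rightarrow> complex"
  assumes "finite B"
    and add: "\<And>x y. f (x + y) = f x + f y" and scale: "\<And>a x. f (a *\<^sub>C x) = a * f x"
  shows "\<exists>z\<in>cspan B. \<forall>x\<in>cspan B. f x = cinner x z"
  using assms
proof (induction B arbitrary: f rule: finite_induct)
  case empty
  have "f 0 = 0" using empty(1)[of 0 0] by simp
  then show ?case by simp
next
  case (insert b B)
  show ?case
  proof (cases "b \<in> cspan B")
    case True
    then have "cspan (insert b B) = cspan B" by (rule complex_vector.span_redundant)
    then show ?thesis using insert.IH[of f] insert.prems by simp
  next
    case False
    obtain z where z: "z \<in> cspan B" "\<And>x. x \<in> cspan B \<Longrightarrow> f x = cinner x z"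
      using insert.IH[of f] insert.prems by blast
    obtain p where p: "p \<in> cspan B" "\<And>x. x \<in> cspan B \<Longrightarrow> cinner x b = cinner x p"
      using insert.IH[of "\<lambda>x. cinner x b"] by (auto simp: cinner_add_left cinner_scaleC_left)
    define e where "e = b - p"
    have orth: "cinner x e = 0" if "x \<in> cspan B" for x
      using p(2)[OF that] by (simp add: e_def cinner_diff_right)
    have orth': "cinner e x = 0" if "x \<in> cspan B" for x
      using orth[OF that] cinner_commute[of e x] by simp
    have "e \<noteq> 0" using False p(1) by (auto simp: e_def)
    then have ee: "cinner e e \<noteq> 0" by (simp add: cinner_eq_zero_iff)
    define c where "c = f e / cinner e e"
    define w where "w = z + cnj c *\<^sub>C e"
    have inc: "cspan B \<subseteq> cspan (insert b B)"
      by (intro complex_vector.span_mono) auto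
    have e_in: "e \<in> cspan (insert b B)"
      unfolding e_def using inc p(1)
      by (intro complex_vector.span_diff) (auto intro: complex_vector.span_base)
    have w_in: "w \<in> cspan (insert b B)"
      unfolding w_def using inc z(1) e_in
      by (auto intro!: complex_vector.span_add complex_vector.span_scale)
    have "f x = cinner x w" if "x \<in> cspan (insert b B)" for x
    proof -
      obtain k where k: "x - k *\<^sub>C b \<in> cspan B"
        using \<open>x \<in> cspan (insert b B)\<close> by (auto simp: complex_vector.span_insert)
      define y where "y = x - k *\<^sub>C b + k *\<^sub>C p"
      have y: "y \<in> cspan B"
        unfolding y_def using k p(1)
        by (intro complex_vector.span_add complex_vector.span_scale)
      have x: "x = y + k *\<^sub>C e"
        by (simp add: y_def e_def complex_vector.scale_right_diff_distrib)
      have "f x = cinner y z + k * f e"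
        unfolding x using insert.prems z(2)[OF y] by simp
      also have "\<dots> = cinner x w"
        unfolding x w_def using ee orth[OF y] orth'[OF z(1)]
        by (simp add: cinner_add_left cinner_add_right cinner_scaleC_left cinner_scaleC_right c_def)
      finally show ?thesis .
    qed
    with w_in show ?thesis by blast
  qed
qed

lemma adjoint_op_works:
  fixes T :: "'a::finite_dim_hilbert \<Rightarrow> 'a"
  assumes "clinear T"
  shows "cinner (T x) y = cinner x (adjoint_op T y)"
proof -
  obtain B :: "'a set" where B: "finite B" "cspan B = UNIV" using finite_cspan by blast
  have "\<exists>z. \<forall>x. cinner (T x) y = cinner x z" for y
    using riesz_span[OF B(1), of "\<lambda>x. cinner (T x) y"] B(2)
    by (auto simp: clinear_add[OF assms] clinear_scaleC[OF assms] cinner_add_left cinner_scaleC_left)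
  then obtain T' where T': "\<forall>x y. cinner (T x) y = cinner x (T' y)" by metis
  then have "\<exists>!T'. \<forall>x y. cinner (T x) y = cinner x (T' y)"
    by (metis (no_types, lifting) ext cinner_ext_right)
  from theI'[OF this] show ?thesis unfolding adjoint_op_def by blast
qed

lemma adjoint_op_id: "adjoint_op (\<lambda>x. x) = (\<lambda>x::'a::complex_inner. x)"
  unfolding adjoint_op_def
  by (rule the_equality) (auto intro!: ext intro: cinner_ext_right)

section \<open>Operator tuples\<close>

text \<open>A \<open>d\<close>-tuple is a function on \<open>nat\<close> of which only the values at \<open>0, \<dots>, d - 1\<close> matter;
  multiindices are zero outside this range, so that there are finitely many of each size.\<close>

definition commuting_tuple :: "nat \<Rightarrow> (nat \<Rightarrow> 'a::complex_inner \<Rightarrow> 'a) \<Rightarrow> bool"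
  where "commuting_tuple d T \<longleftrightarrow>
    (\<forall>j<d. clinear (T j)) \<and> (\<forall>j<d. \<forall>k<d. T j \<circ> T k = T k \<circ> T j)"

definition multiindices :: "nat \<Rightarrow> nat \<Rightarrow> (nat \<Rightarrow> nat) set"
  where "multiindices d k = {\<alpha>. (\<forall>j\<ge>d. \<alpha> j = 0) \<and> (\<Sum>j<d. \<alpha> j) = k}"

primrec tuple_power :: "nat \<Rightarrow> (nat \<Rightarrow> 'a \<Rightarrow> 'a) \<Rightarrow> (nat \<Rightarrow> nat) \<Rightarrow> 'a \<Rightarrow> 'a"
  where
    "tuple_power 0 T \<alpha> = id"
  | "tuple_power (Suc d) T \<alpha> = tuple_power d T \<alpha> \<circ> (T d ^^ \<alpha> d)"

definition isometric_tuple ::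
    "('a::complex_inner \<Rightarrow> 'a) \<Rightarrow> nat \<Rightarrow> nat \<Rightarrow> (nat \<Rightarrow> 'a \<Rightarrow> 'a) \<Rightarrow> bool"
  where "isometric_tuple A m d T \<longleftrightarrow> commuting_tuple d T \<and>
    (\<forall>x. (\<Sum>k\<le>m. ((-1) ^ (m - k) * of_nat (m choose k)) *\<^sub>C
        (\<Sum>\<alpha>\<in>multiindices d k. (fact k / (\<Prod>j<d. fact (\<alpha> j))) *\<^sub>C
          adjoint_op (tuple_power d T \<alpha>) (A (tuple_power d T \<alpha> x)))) = 0)"

definition spherical_isometric_tuple ::
    "('a::complex_inner \<Rightarrow> 'a) \<Rightarrow> nat \<Rightarrow> (nat \<Rightarrow> 'a \<Rightarrow> 'a) \<Rightarrow> bool"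
  where "spherical_isometric_tuple A d S \<longleftrightarrow> isometric_tuple A 1 d S"

definition nilpotent_tuple :: "nat \<Rightarrow> (nat \<Rightarrow> 'a::complex_inner \<Rightarrow> 'a) \<Rightarrow> bool"
  where "nilpotent_tuple d N \<longleftrightarrow> commuting_tuple d N \<and>
    (\<exists>n>0. \<forall>\<alpha>\<in>multiindices d n. tuple_power d N \<alpha> = (\<lambda>x. 0))"

lemma finite_multiindices: "finite (multiindices d k)"
proof -
  have "multiindices d k \<subseteq> {\<alpha>. \<forall>j. (j \<in> {..<d} \<longrightarrow> \<alpha> j \<in> {..k}) \<and> (j \<notin> {..<d} \<longrightarrow> \<alpha> j = 0)}"
    by (auto simp: multiindices_def intro!: member_le_sum)
  moreover have "finite \<dots>"
    by (rule finite_set_of_finite_funs) auto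
  ultimately show ?thesis by (rule finite_subset)
qed

lemma multiindices_0: "multiindices d 0 = {\<lambda>j. 0}"
proof -
  have "\<alpha> = (\<lambda>j. 0)" if "\<alpha> \<in> multiindices d 0" for \<alpha>
  proof
    fix j show "\<alpha> j = 0"
      using that by (cases "j < d") (auto simp: multiindices_def)
  qed
  then show ?thesis by (auto simp: multiindices_def)
qed

lemma multiindices_1: "multiindices d 1 = (\<lambda>i j. if j = i then 1 else 0) ` {..<d}"
proof (rule set_eqI, rule iffI)
  fix \<alpha> assume a: "\<alpha> \<in> multiindices d 1"
  then have "sum \<alpha> {..<d} = Suc 0" "\<forall>j\<ge>d. \<alpha> j = 0" by (auto simp: multiindices_def)
  then obtain i where "i < d" "\<alpha> i = 1" "\<forall>j\<in>{..<d}. j \<noteq> i \<longrightarrow> \<alpha> j = 0"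
    by (auto simp: sum_eq_Suc0_iff)
  then have "\<alpha> = (\<lambda>j. if j = i then 1 else 0)"
    using \<open>\<forall>j\<ge>d. \<alpha> j = 0\<close> by (auto simp: fun_eq_iff not_less[symmetric])
  with \<open>i < d\<close> show "\<alpha> \<in> (\<lambda>i j. if j = i then 1 else 0) ` {..<d}" by blast
qed (auto simp: multiindices_def)

lemma tuple_power_0: "tuple_power d T (\<lambda>j. 0) = id"
  by (induction d) auto

lemma tuple_power_unit:
  "tuple_power d T (\<lambda>j. if j = i then 1 else 0) = (if i < d then T i else id)"
  by (induction d) (auto simp: fun_eq_iff less_Suc_eq)

lemma spherical_isometric_tuple_iff:
  "spherical_isometric_tuple A d S \<longleftrightarrow>
    commuting_tuple d S \<and> (\<forall>x. (\<Sum>j<d. adjoint_op (S j) (A (S j x))) = A x)"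
proof -
  have inj: "inj_on (\<lambda>i j. if j = i then 1 else 0 :: nat) {..<d}"
    by (auto simp: inj_on_def fun_eq_iff split: if_splits)
  have fact1: "(\<Prod>j<d. fact (if j = i then 1 else 0)) = (1::complex)" for i
    by (rule prod.neutral) auto
  have "(\<Sum>\<alpha>\<in>multiindices d 1. (fact 1 / (\<Prod>j<d. fact (\<alpha> j))) *\<^sub>C
          adjoint_op (tuple_power d S \<alpha>) (A (tuple_power d S \<alpha> x)))
      = (\<Sum>j<d. adjoint_op (S j) (A (S j x)))" for x
    unfolding multiindices_1
    by (subst sum.reindex[OF inj])
      (simp only: o_def fact1, auto simp: tuple_power_unit intro!: sum.cong)
  then show ?thesis
    by (auto simp: spherical_isometric_tuple_def isometric_tuple_def multiindices_0 tuple_power_0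
        adjoint_op_id id_def)
qed

end

theory Submission
  imports Defs "HOL-Computational_Algebra.Fundamental_Theorem_Algebra"
    "HOL-Computational_Algebra.Polynomial_Factorial" "HOL-Computational_Algebra.Field_as_Ring"
begin

text \<open>Let \<open>S j\<close> be the diagonalizable part of \<open>T j\<close>. Being a polynomial in \<open>T j\<close>, it commutes
  with the commutant of \<open>T j\<close>, and \<open>N j = T j - S j\<close> is nilpotent, so only the identity
  \<open>(\<Sum>j<d. \<langle>A (S j x), S j y\<rangle>) = \<langle>A x, y\<rangle>\<close> is at stake. The joint generalized eigenspaces of \<open>T\<close>
  span the whole space, and for \<open>x\<close> and \<open>y\<close> in those with eigenvalues \<open>\<nu>\<close> and \<open>\<mu>\<close> the left-hand
  side is \<open>(\<Sum>j<d. \<nu> j * cnj (\<mu> j)) * \<langle>A x, y\<rangle>\<close>. So one needs \<open>\<langle>A x, y\<rangle> = 0\<close> whenever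
  \<open>c = (\<Sum>j<d. \<nu> j * cnj (\<mu> j)) \<noteq> 1\<close>. This holds since on forms on this pair of eigenspaces the map
  \<open>\<Phi>\<close> sending \<open>a(x, y)\<close> to \<open>\<Sum>j<d. a(T j x, T j y)\<close> is \<open>c\<close> plus a nilpotent map, so \<open>\<Phi> - 1\<close> is
  invertible, while the isometry condition says that \<open>(\<Phi> - 1) ^ m\<close> annihilates \<open>\<langle>A x, y\<rangle>\<close>.\<close>

section \<open>Linear maps\<close>

lemma clinear_0: "clinear f \<Longrightarrow> f 0 = 0"
  using clinear_scaleC[of f 0 0] by simp

lemma clinear_diff: "clinear f \<Longrightarrow> f (x - y) = f x - f y"
  using clinear_add[of f "x - y" y] by (simp add: algebra_simps)

lemma clinear_funpow:
  fixes f :: "'a::complex_inner \<Rightarrow> 'a"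
  shows "clinear f \<Longrightarrow> clinear (f ^^ n)"
proof (induction n)
  case 0
  show ?case by (rule clinearI) simp_all
next
  case (Suc n)
  then show ?case
    by (intro clinearI) (simp_all add: clinear_add clinear_scaleC)
qed

lemma clinear_shift: "clinear f \<Longrightarrow> clinear (\<lambda>x. f x - a *\<^sub>C x)"
  by (rule clinearI)
    (simp_all add: clinear_add clinear_scaleC complex_vector.scale_right_distrib
      complex_vector.scale_right_diff_distrib mult.commute)

lemma clinear_sum_fun:
  assumes "\<And>i. i \<in> I \<Longrightarrow> clinear (f i)"
  shows "clinear (\<lambda>x. \<Sum>i\<in>I. f i x)"
  using assms
  by (intro clinearI)
    (simp_all add: clinear_add clinear_scaleC sum.distrib complex_vector.scale_sum_right)

lemma funpow_commute:
  fixes g :: "'a \<Rightarrow> 'a"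
  assumes "\<And>x. f (g x) = g (f x)"
  shows "f ((g ^^ n) x) = (g ^^ n) (f x)"
  using assms by (induction n) simp_all

lemma clinear_commute_shift_power:
  assumes "clinear U" and "\<And>x. U (T x) = T (U x)"
  shows "U (((\<lambda>x. T x - a *\<^sub>C x) ^^ n) x) = ((\<lambda>x. T x - a *\<^sub>C x) ^^ n) (U x)"
  by (rule funpow_commute) (simp add: assms clinear_diff clinear_scaleC)

lemma funpow_eq_0_mono:
  fixes f :: "'a::complex_inner \<Rightarrow> 'a"
  assumes "clinear f" and "(f ^^ n) x = 0" and "n \<le> k"
  shows "(f ^^ k) x = 0"
proof -
  have "(f ^^ k) x = (f ^^ (k - n)) ((f ^^ n) x)"
    using \<open>n \<le> k\<close> by (metis comp_apply funpow_add le_add_diff_inverse2)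
  with assms show ?thesis
    by (simp add: clinear_0[OF clinear_funpow])
qed

section \<open>Polynomials in an operator\<close>

definition poly_op :: "('a::complex_inner \<Rightarrow> 'a) \<Rightarrow> complex poly \<Rightarrow> 'a \<Rightarrow> 'a"
  where "poly_op T p x = (\<Sum>i\<le>degree p. coeff p i *\<^sub>C (T ^^ i) x)"

lemma poly_op_0 [simp]: "poly_op T 0 x = 0"
  by (simp add: poly_op_def)

lemma poly_op_pCons: "poly_op T (pCons a p) x = a *\<^sub>C x + poly_op T p (T x)"
proof (cases "p = 0")
  case False
  then show ?thesis
    by (simp add: poly_op_def sum.atMost_Suc_shift funpow_Suc_right del: sum.atMost_Suc funpow.simps)
qed (simp add: poly_op_def)

lemma poly_op_1 [simp]: "poly_op T 1 x = x"
  by (simp add: poly_op_def)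

lemma poly_op_add: "poly_op T (p + q) x = poly_op T p x + poly_op T q x"
  by (induction p q arbitrary: x rule: poly_induct2)
    (simp_all add: poly_op_pCons algebra_simps)

lemma poly_op_diff: "poly_op T (p - q) x = poly_op T p x - poly_op T q x"
  using poly_op_add[of T "p - q" q x] by (simp add: algebra_simps)

lemma poly_op_sum: "poly_op T (sum p I) x = (\<Sum>i\<in>I. poly_op T (p i) x)"
  by (induction I rule: infinite_finite_induct) (simp_all add: poly_op_add)

lemma poly_op_smult: "poly_op T (smult a p) x = a *\<^sub>C poly_op T p x"
  by (induction p arbitrary: x)
    (simp_all add: poly_op_pCons scaleC_add_right)

lemma poly_op_monom: "poly_op T (monom a n) x = a *\<^sub>C (T ^^ n) x"
  by (induction n arbitrary: x)
    (simp_all add: monom_0 monom_Suc poly_op_pCons funpow_Suc_right del: funpow.simps(2))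

lemma poly_op_linear: "poly_op T [:-a, 1:] = (\<lambda>x. T x - a *\<^sub>C x)"
  by (simp add: fun_eq_iff poly_op_pCons)

lemma poly_op_commute:
  assumes "clinear U" and "\<And>x. U (T x) = T (U x)"
  shows "U (poly_op T p x) = poly_op T p (U x)"
  by (induction p arbitrary: x)
    (simp_all add: poly_op_pCons assms clinear_0 clinear_add clinear_scaleC)

context
  fixes T :: "'a::complex_inner \<Rightarrow> 'a"
  assumes T: "clinear T"
begin

lemma clinear_poly_op: "clinear (poly_op T p)"
proof (rule clinearI)
  show "poly_op T p (x + y) = poly_op T p x + poly_op T p y" for x y
    by (induction p arbitrary: x y)
      (simp_all add: poly_op_pCons clinear_add[OF T] algebra_simps)
  show "poly_op T p (a *\<^sub>C x) = a *\<^sub>C poly_op T p x" for a x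
    by (induction p arbitrary: x)
      (simp_all add: poly_op_pCons clinear_scaleC[OF T] scaleC_add_right mult.commute)
qed

lemma poly_op_mult: "poly_op T (p * q) x = poly_op T p (poly_op T q x)"
  by (induction p arbitrary: x)
    (simp_all add: poly_op_pCons poly_op_add poly_op_smult
      poly_op_commute[OF T, of T] scaleC_add_right)

lemma poly_op_power: "poly_op T (p ^ n) x = (poly_op T p ^^ n) x"
  by (induction n) (simp_all add: poly_op_mult)

lemma poly_op_dvd:
  assumes "p dvd q" and "poly_op T p x = 0"
  shows "poly_op T q x = 0"
proof -
  obtain r where "q = r * p" using \<open>p dvd q\<close> by (auto simp: dvd_def mult.commute)
  then show ?thesis
    using assms(2) by (simp add: poly_op_mult clinear_0[OF clinear_poly_op])
qed

end

section \<open>Annihilating polynomials\<close>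

text \<open>In a finite dimensional space the iterates of x under T either repeat or form an
  infinite, hence linearly dependent, set; both give a nonzero polynomial relation. Repetition needs
  its own case because dependence of a set does not see equal iterates.\<close>

lemma vector_annihilator:
  fixes T :: "'a::finite_dim_hilbert \<Rightarrow> 'a"
  shows "\<exists>f. f \<noteq> 0 \<and> poly_op T f x = 0"
proof (cases "inj (\<lambda>i. (T ^^ i) x)")
  case True
  obtain B :: "'a set" where B: "finite B" "cspan B = UNIV"
    using finite_cspan by blast
  have "infinite (range (\<lambda>i. (T ^^ i) x))"
    using True by (simp add: finite_image_iff)
  then have "complex_vector.dependent (range (\<lambda>i. (T ^^ i) x))"
    using complex_vector.independent_span_bound[OF B(1)] B(2) by auto
  then obtain V u v where V: "finite V" "V \<subseteq> range (\<lambda>i. (T ^^ i) x)"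
      "(\<Sum>v\<in>V. u v *\<^sub>C v) = 0" "v \<in> V" "u v \<noteq> 0"
    unfolding complex_vector.dependent_explicit by blast
  then obtain I where I: "V = (\<lambda>i. (T ^^ i) x) ` I"
    by (meson subset_image_iff)
  have inj: "inj_on (\<lambda>i. (T ^^ i) x) I"
    using True by (rule inj_on_subset) simp
  have "finite I" using V(1) I inj by (simp add: finite_image_iff)
  define f where "f = (\<Sum>i\<in>I. monom (u ((T ^^ i) x)) i)"
  have "poly_op T f x = (\<Sum>i\<in>I. u ((T ^^ i) x) *\<^sub>C (T ^^ i) x)"
    by (simp add: f_def poly_op_sum poly_op_monom)
  also have "\<dots> = 0"
    using V(3) unfolding I by (simp add: sum.reindex[OF inj])
  finally have "poly_op T f x = 0" .
  moreover obtain k where "k \<in> I" "v = (T ^^ k) x" using V(4) I by blast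
  then have "coeff f k \<noteq> 0"
    using \<open>finite I\<close> V(5) by (simp add: f_def coeff_sum)
  then have "f \<noteq> 0" by auto
  ultimately show ?thesis by blast
next
  case False
  then obtain i j where ij: "i \<noteq> j" "(T ^^ i) x = (T ^^ j) x"
    by (auto simp: inj_def)
  define f :: "complex poly" where "f = monom 1 i - monom 1 j"
  have "coeff f i = 1" using ij by (simp add: f_def)
  then have "f \<noteq> 0" by auto
  moreover have "poly_op T f x = 0"
    using ij by (simp add: f_def poly_op_diff poly_op_monom)
  ultimately show ?thesis by blast
qed

text \<open>The product of annihilators for the vectors of a finite spanning set kills each of these
  vectors, hence by linearity the whole space.\<close>

lemma operator_annihilator:
  fixes T :: "'a::finite_dim_hilbert \<Rightarrow> 'a"
  assumes T: "clinear T"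
  shows "\<exists>f. f \<noteq> 0 \<and> (\<forall>x. poly_op T f x = 0)"
proof -
  obtain B :: "'a set" where B: "finite B" "cspan B = UNIV"
    using finite_cspan by blast
  obtain g where g: "\<And>b. g b \<noteq> 0" "\<And>b. poly_op T (g b) b = 0"
    using vector_annihilator[of T] by metis
  have "poly_op T (prod g B) x = 0" for x
  proof -
    have "x \<in> cspan B" using B(2) by simp
    then show ?thesis
    proof (induction rule: complex_vector.span_induct)
      case base
      show ?case
        unfolding complex_vector.subspace_def
        using clinear_0[OF clinear_poly_op[OF T]] clinear_add[OF clinear_poly_op[OF T]]
          clinear_scaleC[OF clinear_poly_op[OF T]] by auto
    next
      case (step b)
      then show ?case
        using B(1) g(2) by (metis dvd_prodI poly_op_dvd[OF T])
    qed
  qed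
  moreover have "prod g B \<noteq> 0" using B(1) g(1) by simp
  ultimately show ?thesis by blast
qed

lemma split_annihilator:
  fixes T :: "'a::finite_dim_hilbert \<Rightarrow> 'a"
  assumes T: "clinear T"
  shows "\<exists>\<Lambda> n. finite \<Lambda> \<and> n > 0 \<and> (\<forall>x. poly_op T (\<Prod>a\<in>\<Lambda>. [:-a, 1:] ^ n) x = 0)"
proof -
  obtain f where f: "f \<noteq> 0" "\<And>x. poly_op T f x = 0"
    using operator_annihilator[OF T] by blast
  define \<Lambda> where "\<Lambda> = {z. poly f z = 0}"
  have "f = smult (lead_coeff f) (\<Prod>a\<in>\<Lambda>. [:-a, 1:] ^ order a f)"
    unfolding \<Lambda>_def by (rule complex_poly_decompose[symmetric])
  \<comment> \<open>\<open>Suc (degree f)\<close> bounds every root multiplicity, so a single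
    positive exponent serves all roots.\<close>
  also have "\<dots> dvd (\<Prod>a\<in>\<Lambda>. [:-a, 1:] ^ Suc (degree f))"
  proof (rule smult_dvd)
    show "(\<Prod>a\<in>\<Lambda>. [:-a, 1:] ^ order a f) dvd (\<Prod>a\<in>\<Lambda>. [:-a, 1:] ^ Suc (degree f))"
      using order_degree[OF f(1)] by (intro prod_dvd_prod le_imp_power_dvd) (simp add: le_SucI)
  qed (use f in simp)
  finally have "poly_op T (\<Prod>a\<in>\<Lambda>. [:-a, 1:] ^ Suc (degree f)) x = 0" for x
    using f(2) poly_op_dvd[OF T] by blast
  moreover have "finite \<Lambda>"
    unfolding \<Lambda>_def using f(1) by (rule poly_roots_finite)
  ultimately show ?thesis by blast
qed

section \<open>Primary decomposition\<close>

lemma coprime_linear_power: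
  fixes a b :: complex
  assumes "a \<noteq> b"
  shows "coprime ([:-a, 1:] ^ n) ([:-b, 1:] ^ k)"
proof -
  have "coprime [:-a, 1:] [:-b, 1:]"
  proof (rule coprimeI)
    fix p assume "p dvd [:-a, 1:]" "p dvd [:-b, 1:]"
    then have "p dvd [:-a, 1:] - [:-b, 1:]" by (rule dvd_diff)
    also have "[:-a, 1:] - [:-b, 1:] = [:b - a:]" by simp
    also have "[:b - a:] dvd 1"
      using assms by (intro dvdI[of _ _ "[:1 / (b - a):]"]) (simp add: one_pCons)
    finally show "is_unit p" .
  qed
  then show ?thesis
    by simp
qed

lemma prod_coprime_dvd:
  fixes f :: "'b \<Rightarrow> complex poly"
  assumes "finite I" and "\<And>i j. i \<in> I \<Longrightarrow> j \<in> I \<Longrightarrow> i \<noteq> j \<Longrightarrow> coprime (f i) (f j)"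
    and "\<And>i. i \<in> I \<Longrightarrow> f i dvd p"
  shows "prod f I dvd p"
  using assms
proof (induction I rule: finite_induct)
  case (insert i I)
  have "coprime (f i) (prod f I)"
    using insert by (intro prod_coprime_right) auto
  then show ?case
    using insert by (auto intro: divides_mult)
qed simp

text \<open>Bezout, as in the Chinese remainder theorem: powers at distinct roots are coprime, so
  \<open>q a\<close> can be 1 modulo the power at a and 0 modulo the others. Evaluated at an
  operator killed by the full product, \<open>q a\<close> becomes the spectral projection for
  a.\<close>

lemma primary_idempotents:
  fixes \<Lambda> :: "complex set"
  assumes "finite \<Lambda>"
  shows "\<exists>q. \<forall>a\<in>\<Lambda>. [:-a, 1:] ^ n dvd q a - 1 \<and> (\<Prod>b\<in>\<Lambda> - {a}. [:-b, 1:] ^ n) dvd q a"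
proof (rule bchoice, rule ballI)
  fix a
  define u v where "u = [:-a, 1:] ^ n" and "v = (\<Prod>b\<in>\<Lambda> - {a}. [:-b, 1:] ^ n)"
  have "coprime u v"
    unfolding u_def v_def by (intro prod_coprime_right coprime_linear_power) auto
  then have "gcd u v = 1" by simp
  then obtain s t where st: "s * u + t * v = 1"
    using bezout_coefficients_fst_snd[of u v] by metis
  then have "t * v - 1 = - s * u" by (simp add: algebra_simps)
  then have "u dvd t * v - 1" "v dvd t * v" by simp_all
  then show "\<exists>q. [:-a, 1:] ^ n dvd q - 1 \<and> (\<Prod>b\<in>\<Lambda> - {a}. [:-b, 1:] ^ n) dvd q"
    unfolding u_def v_def by blast
qed

text \<open>\<open>\<Lambda>\<close> contains the spectrum of \<open>T\<close> and the maps \<open>P a\<close> are its spectral projections, so that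
  \<open>S\<close> is the diagonalizable and \<open>T - S\<close> the nilpotent part of \<open>T\<close>.\<close>

definition jordan_chevalley ::
    "('a::complex_inner \<Rightarrow> 'a) \<Rightarrow> ('a \<Rightarrow> 'a) \<Rightarrow> (complex \<Rightarrow> 'a \<Rightarrow> 'a) \<Rightarrow> complex set \<Rightarrow> nat \<Rightarrow> bool"
  where "jordan_chevalley T S P \<Lambda> n \<longleftrightarrow> clinear S \<and>
    (\<forall>x. x = (\<Sum>a\<in>\<Lambda>. P a x)) \<and>
    (\<forall>a\<in>\<Lambda>. \<forall>x. ((\<lambda>x. T x - a *\<^sub>C x) ^^ n) (P a x) = 0) \<and>
    (\<forall>a\<in>\<Lambda>. \<forall>x. ((\<lambda>x. T x - a *\<^sub>C x) ^^ n) x = 0 \<longrightarrow> S x = a *\<^sub>C x) \<and>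
    (\<forall>x. ((\<lambda>x. T x - S x) ^^ n) x = 0) \<and>
    (\<forall>U. clinear U \<longrightarrow> (\<forall>x. U (T x) = T (U x)) \<longrightarrow>
      (\<forall>x. U (S x) = S (U x)) \<and> (\<forall>a x. U (P a x) = P a (U x)))"

text \<open>S is \<open>p\<close> evaluated at T, where \<open>p\<close> is congruent to a modulo
  the n-th power of X - a for every a. The clauses on kernels and projections then reduce to
  divisibility by a polynomial that kills the vectors in question, and polynomials in T commute with
  the commutant of T.\<close>

lemma jordan_chevalley_exists:
  fixes T :: "'a::finite_dim_hilbert \<Rightarrow> 'a"
  assumes T: "clinear T"
  shows "\<exists>S P \<Lambda> n. jordan_chevalley T S P \<Lambda> n"
proof -
  obtain \<Lambda> n where fin: "finite \<Lambda>" and n: "n > 0"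
    and ann: "\<And>x. poly_op T (\<Prod>a\<in>\<Lambda>. [:-a, 1:] ^ n) x = 0"
    using split_annihilator[OF T] by blast
  obtain q where q1: "\<And>a. a \<in> \<Lambda> \<Longrightarrow> [:-a, 1:] ^ n dvd q a - 1"
    and q0: "\<And>a. a \<in> \<Lambda> \<Longrightarrow> (\<Prod>b\<in>\<Lambda> - {a}. [:-b, 1:] ^ n) dvd q a"
    using primary_idempotents[OF fin, of n] by blast
  define p where "p = (\<Sum>a\<in>\<Lambda>. smult a (q a))"
  have q0': "[:-b, 1:] ^ n dvd q a" if "a \<in> \<Lambda>" "b \<in> \<Lambda>" "a \<noteq> b" for a b
    using that fin by (intro dvd_trans[OF dvd_prodI q0[OF that(1)]]) auto
  \<comment> \<open>With \<open>c\<close> constantly 1 this shows that the projections sum to the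
    identity; with \<open>c\<close> the identity it gives the congruences for
    \<open>p\<close>.\<close>
  have sum_mod: "[:-a, 1:] ^ n dvd (\<Sum>b\<in>\<Lambda>. smult (c b) (q b)) - [:c a:]" if a: "a \<in> \<Lambda>" for a c
  proof -
    have "(\<Sum>b\<in>\<Lambda>. smult (c b) (q b)) - [:c a:]
        = smult (c a) (q a - 1) + (\<Sum>b\<in>\<Lambda> - {a}. smult (c b) (q b))"
      using fin a by (simp add: sum.remove smult_diff_right)
    also have "[:-a, 1:] ^ n dvd \<dots>"
      using a q1 q0' by (intro dvd_add dvd_sum dvd_smult) auto
    finally show ?thesis .
  qed
  have prod_dvd: "(\<Prod>a\<in>\<Lambda>. [:-a, 1:] ^ n) dvd r" if "\<And>a. a \<in> \<Lambda> \<Longrightarrow> [:-a, 1:] ^ n dvd r" for r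
    using fin that by (intro prod_coprime_dvd coprime_linear_power) auto
  have "clinear (poly_op T p)" by (rule clinear_poly_op[OF T])
  moreover have "x = (\<Sum>a\<in>\<Lambda>. poly_op T (q a) x)" for x
  proof -
    have "(\<Prod>a\<in>\<Lambda>. [:-a, 1:] ^ n) dvd sum q \<Lambda> - 1"
      using sum_mod[of _ "\<lambda>_. 1"] by (intro prod_dvd) (simp add: one_pCons)
    then have "poly_op T (sum q \<Lambda> - 1) x = 0"
      using ann poly_op_dvd[OF T] by blast
    then show ?thesis by (simp add: poly_op_diff poly_op_sum)
  qed
  moreover have "((\<lambda>x. T x - a *\<^sub>C x) ^^ n) (poly_op T (q a) x) = 0" if a: "a \<in> \<Lambda>" for a x
  proof -
    have "(\<Prod>a\<in>\<Lambda>. [:-a, 1:] ^ n) dvd [:-a, 1:] ^ n * q a"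
      using fin a q0[OF a] by (simp add: prod.remove mult_dvd_mono)
    then have "poly_op T ([:-a, 1:] ^ n * q a) x = 0"
      using ann poly_op_dvd[OF T] by blast
    then show ?thesis by (simp add: poly_op_mult[OF T] poly_op_power[OF T] poly_op_linear)
  qed
  moreover have "poly_op T p x = a *\<^sub>C x"
    if a: "a \<in> \<Lambda>" and x: "((\<lambda>x. T x - a *\<^sub>C x) ^^ n) x = 0" for a x
  proof -
    have "poly_op T ([:-a, 1:] ^ n) x = 0"
      using x by (simp add: poly_op_power[OF T] poly_op_linear)
    then have "poly_op T (p - [:a:]) x = 0"
      using sum_mod[OF a, of "\<lambda>a. a"] poly_op_dvd[OF T] unfolding p_def by blast
    then show ?thesis by (simp add: poly_op_diff poly_op_pCons)
  qed
  moreover have "((\<lambda>x. T x - poly_op T p x) ^^ n) x = 0" for x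
  proof -
    \<comment> \<open>Each X - a divides X - p, so the n-th power of X - p is a multiple of the
      annihilator. Positivity of \<open>n\<close> lets the congruence for \<open>p\<close> descend
      from the n-th power to X - a itself.\<close>
    have "(\<Prod>a\<in>\<Lambda>. [:-a, 1:] ^ n) dvd ([:0, 1:] - p) ^ n"
    proof (rule prod_dvd)
      fix a assume a: "a \<in> \<Lambda>"
      have "[:-a, 1:] dvd [:-a, 1:] ^ n" using n by simp
      also have "\<dots> dvd p - [:a:]"
        using sum_mod[OF a, of "\<lambda>a. a"] unfolding p_def .
      finally have "[:-a, 1:] dvd [:-a, 1:] - (p - [:a:])" by (rule dvd_diff[OF dvd_refl])
      also have "\<dots> = [:0, 1:] - p" by simp
      finally show "[:-a, 1:] ^ n dvd ([:0, 1:] - p) ^ n" by (rule dvd_power_same)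
    qed
    then have "poly_op T (([:0, 1:] - p) ^ n) x = 0"
      using ann poly_op_dvd[OF T] by blast
    moreover have "poly_op T ([:0, 1:] - p) = (\<lambda>x. T x - poly_op T p x)"
      by (simp add: fun_eq_iff poly_op_diff poly_op_pCons)
    ultimately show ?thesis by (simp add: poly_op_power[OF T])
  qed
  ultimately have "jordan_chevalley T (poly_op T p) (\<lambda>a. poly_op T (q a)) \<Lambda> n"
    unfolding jordan_chevalley_def by (auto simp: poly_op_commute)
  then show ?thesis by blast
qed

section \<open>Joint generalized eigenvectors\<close>

text \<open>Each operator has its own exponent so that a single one can be lowered. Exponent 0 at
  some j < d leaves only the zero vector, the base of the induction in
  \<open>isometric_form_eq_0\<close>.\<close>

definition joint_kernel ::
    "nat \<Rightarrow> (nat \<Rightarrow> 'a::complex_inner \<Rightarrow> 'a) \<Rightarrow> (nat \<Rightarrow> complex) \<Rightarrow> (nat \<Rightarrow> nat) \<Rightarrow> 'a set"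
  where "joint_kernel d T \<nu> e = {x. \<forall>j<d. ((\<lambda>x. T j x - \<nu> j *\<^sub>C x) ^^ e j) x = 0}"

lemma commuting_tuple_linear: "commuting_tuple d T \<Longrightarrow> j < d \<Longrightarrow> clinear (T j)"
  by (simp add: commuting_tuple_def)

lemma commuting_tuple_commute:
  "commuting_tuple d T \<Longrightarrow> j < d \<Longrightarrow> k < d \<Longrightarrow> T j (T k x) = T k (T j x)"
  by (simp add: commuting_tuple_def fun_eq_iff)

lemma joint_kernel_invariant:
  assumes "clinear U" and "\<And>j x. j < d \<Longrightarrow> U (T j x) = T j (U x)"
    and "x \<in> joint_kernel d T \<nu> e"
  shows "U x \<in> joint_kernel d T \<nu> e"
  using assms clinear_commute_shift_power[of U "T _", symmetric]
  by (simp add: joint_kernel_def clinear_0)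

lemma joint_kernel_funpow:
  assumes "commuting_tuple d T" and "j < d" and "x \<in> joint_kernel d T \<nu> e"
  shows "(T j ^^ k) x \<in> joint_kernel d T \<nu> e"
proof (rule joint_kernel_invariant[OF clinear_funpow _ assms(3)])
  show "(T j ^^ k) (T i x) = T i ((T j ^^ k) x)" if "i < d" for i x
    using funpow_commute[of "T i" "T j"] commuting_tuple_commute[OF assms(1) that assms(2)] by simp
qed (rule commuting_tuple_linear[OF assms(1,2)])

text \<open>The shift uses up one of its own factors, and by commutativity it preserves the kernel
  conditions of the other operators.\<close>

lemma joint_kernel_shift:
  assumes "commuting_tuple d T" and "j < d" and "e j > 0" and "x \<in> joint_kernel d T \<nu> e"
  shows "T j x - \<nu> j *\<^sub>C x \<in> joint_kernel d T \<nu> (e(j := e j - 1))"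
  unfolding joint_kernel_def
proof (intro CollectI allI impI)
  let ?N = "\<lambda>x. T j x - \<nu> j *\<^sub>C x"
  fix i assume i: "i < d"
  have lin: "clinear ?N" by (intro clinear_shift commuting_tuple_linear[OF assms(1,2)])
  have x: "((\<lambda>x. T i x - \<nu> i *\<^sub>C x) ^^ e i) x = 0"
    using assms(4) i by (simp add: joint_kernel_def)
  show "((\<lambda>x. T i x - \<nu> i *\<^sub>C x) ^^ (e(j := e j - 1)) i) (?N x) = 0"
  proof (cases "i = j")
    case True
    have "(?N ^^ (e j - 1)) (?N x) = (?N ^^ e j) x"
      using assms(3) by (metis comp_apply funpow_Suc_right Suc_diff_1)
    then show ?thesis using True x by simp
  next
    case False
    have "?N (T i y) = T i (?N y)" for y
      using commuting_tuple_commute[OF assms(1) i assms(2)] commuting_tuple_linear[OF assms(1) i]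
      by (simp add: clinear_diff clinear_scaleC)
    then have "?N (((\<lambda>x. T i x - \<nu> i *\<^sub>C x) ^^ e i) x)
        = ((\<lambda>x. T i x - \<nu> i *\<^sub>C x) ^^ e i) (?N x)"
      by (intro clinear_commute_shift_power lin)
    then show ?thesis
      using False x clinear_0[OF commuting_tuple_linear[OF assms(1,2)]] by simp
  qed
qed

text \<open>Induction on the number of operators: the projections for \<open>T k\<close> split a
  joint vector of the first k operators. They commute with the powers of the earlier shifts, so the
  components keep the earlier kernel conditions and gain the one for \<open>T k\<close>.\<close>

lemma joint_kernel_span:
  fixes T :: "nat \<Rightarrow> 'a::complex_inner \<Rightarrow> 'a"
  assumes T: "commuting_tuple d T"
    and jc: "\<And>j. j < d \<Longrightarrow> jordan_chevalley (T j) (S j) (P j) (\<Lambda> j) (n j)"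
    and "k \<le> d"
  shows "cspan (\<Union>\<nu>\<in>{\<nu>. \<forall>j<k. \<nu> j \<in> \<Lambda> j}. joint_kernel k T \<nu> n) = UNIV"
  using \<open>k \<le> d\<close>
proof (induction k)
  case 0
  have "joint_kernel 0 T \<nu> n = UNIV" for \<nu>
    by (simp add: joint_kernel_def)
  then show ?case by simp
next
  case (Suc k)
  let ?G = "\<lambda>k. \<Union>\<nu>\<in>{\<nu>. \<forall>j<k. \<nu> j \<in> \<Lambda> j}. joint_kernel k T \<nu> n"
  have k: "k < d" using Suc.prems by simp
  have "?G k \<subseteq> cspan (?G (Suc k))"
  proof
    fix x assume "x \<in> ?G k"
    then obtain \<nu> where \<nu>: "\<And>j. j < k \<Longrightarrow> \<nu> j \<in> \<Lambda> j" and x: "x \<in> joint_kernel k T \<nu> n"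
      by auto
    have "P k a x \<in> ?G (Suc k)" if a: "a \<in> \<Lambda> k" for a
    proof -
      have "((\<lambda>x. T j x - \<nu> j *\<^sub>C x) ^^ n j) (P k a x) = 0" if j: "j < k" for j
      proof -
        let ?U = "(\<lambda>x. T j x - \<nu> j *\<^sub>C x) ^^ n j"
        have Tj: "clinear (T j)" and Tk: "clinear (T k)"
          using T j k by (auto intro: commuting_tuple_linear)
        have U: "clinear ?U" by (intro clinear_funpow clinear_shift Tj)
        have "?U (T k y) = T k (?U y)" for y
          using clinear_commute_shift_power[OF Tk, of "T j"] commuting_tuple_commute[OF T, of k j] j k
          by simp
        then have "?U (P k a x) = P k a (?U x)"
          using jc[OF k] U unfolding jordan_chevalley_def by blast
        moreover have "?U x = 0" using x j by (simp add: joint_kernel_def)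
        moreover have "P k a 0 = 0" \<comment> \<open>\<open>P k a\<close> commutes with the zero map\<close>
        proof -
          have "clinear (\<lambda>x::'a. 0)" by (rule clinearI) simp_all
          moreover have "\<forall>x. 0 = T k 0" using Tk by (simp add: clinear_0)
          ultimately have "\<forall>y. 0 = P k a 0"
            using jc[OF k] unfolding jordan_chevalley_def by blast
          then show ?thesis by simp
        qed
        ultimately show ?thesis by simp
      qed
      moreover have "((\<lambda>x. T k x - a *\<^sub>C x) ^^ n k) (P k a x) = 0"
        using jc[OF k] a by (simp add: jordan_chevalley_def)
      \<comment> \<open>Membership in the kernel of the first k operators constrains
        \<open>\<nu>\<close> only below k, so its value at k can be set to a.\<close>
      ultimately have "P k a x \<in> joint_kernel (Suc k) T (\<nu>(k := a)) n"
        by (auto simp: joint_kernel_def less_Suc_eq)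
      moreover have "\<forall>j<Suc k. (\<nu>(k := a)) j \<in> \<Lambda> j"
        using \<nu> a by (auto simp: less_Suc_eq)
      ultimately show ?thesis by blast
    qed
    then have "(\<Sum>a\<in>\<Lambda> k. P k a x) \<in> cspan (?G (Suc k))"
      by (intro complex_vector.span_sum complex_vector.span_base)
    moreover have "x = (\<Sum>a\<in>\<Lambda> k. P k a x)"
      using jc[OF k] unfolding jordan_chevalley_def by blast
    ultimately show "x \<in> cspan (?G (Suc k))" by simp
  qed
  then have "cspan (?G k) \<subseteq> cspan (?G (Suc k))"
    by (rule complex_vector.span_minimal) (rule complex_vector.subspace_span)
  then show ?case using Suc by auto
qed

section \<open>The multinomial theorem\<close>

text \<open>Induction on d, splitting off the last exponent. After division by k! the sum is a
  convolution of the terms in the first d variables with those in the last one, and the binomial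
  theorem sums it.\<close>

lemma multinomial_theorem:
  fixes z :: "nat \<Rightarrow> complex"
  shows "(\<Sum>\<alpha>\<in>multiindices d k. (fact k / (\<Prod>j<d. fact (\<alpha> j))) * (\<Prod>j<d. z j ^ \<alpha> j))
    = (\<Sum>j<d. z j) ^ k"
proof (induction d arbitrary: k)
  case 0
  have "multiindices 0 k = (if k = 0 then {\<lambda>j. 0} else {})"
    by (auto simp: multiindices_def)
  then show ?case by simp
next
  case (Suc d)
  let ?t = "\<lambda>d \<alpha>. (\<Prod>j<d. z j ^ \<alpha> j) / (\<Prod>j<d. fact (\<alpha> j))"
  have cong: "?t d (\<alpha>(d := i)) = ?t d \<alpha>" for \<alpha> and i :: nat
    by (intro arg_cong2[where f = "(/)"] prod.cong) auto
  have IH: "(\<Sum>\<alpha>\<in>multiindices d i. ?t d \<alpha>) = (\<Sum>j<d. z j) ^ i / fact i" for i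
    using Suc.IH[of i, symmetric] by (simp add: sum_divide_distrib)
  have "(\<Sum>\<alpha>\<in>multiindices (Suc d) k. ?t (Suc d) \<alpha>)
      = (\<Sum>(i, \<alpha>)\<in>(SIGMA i:{..k}. multiindices d (k - i)). ?t d \<alpha> * (z d ^ i / fact i))"
    \<comment> \<open>The last entry is reset to 0 because multiindices vanish outside their range;
      by \<open>cong\<close>, \<open>?t d\<close> does not see the change.\<close>
    by (rule sum.reindex_bij_witness
          [where i = "\<lambda>(i, \<alpha>). \<alpha>(d := i)" and j = "\<lambda>\<alpha>. (\<alpha> d, \<alpha>(d := 0))"])
      (auto simp: multiindices_def fun_eq_iff cong[simplified])
  also have "\<dots> = (\<Sum>i\<le>k. (\<Sum>\<alpha>\<in>multiindices d (k - i). ?t d \<alpha>) * (z d ^ i / fact i))"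
    unfolding sum_distrib_right
    by (rule sum.Sigma[symmetric]) (simp_all add: finite_multiindices)
  also have "\<dots> = (\<Sum>i\<le>k. (\<Sum>j<d. z j) ^ (k - i) / fact (k - i) * (z d ^ i / fact i))"
    unfolding IH ..
  finally have "(\<Sum>\<alpha>\<in>multiindices (Suc d) k. fact k * ?t (Suc d) \<alpha>)
      = fact k * (\<Sum>i\<le>k. (\<Sum>j<d. z j) ^ (k - i) / fact (k - i) * (z d ^ i / fact i))"
    by (simp only: sum_distrib_left[symmetric])
  also have "\<dots> = (\<Sum>i\<le>k. of_nat (k choose i) * z d ^ i * (\<Sum>j<d. z j) ^ (k - i))"
    by (simp add: sum_distrib_left binomial_fact mult_ac)
  also have "\<dots> = (z d + (\<Sum>j<d. z j)) ^ k" by (simp add: binomial_ring)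
  finally show ?case by (simp add: add.commute mult.assoc)
qed

section \<open>Forms on joint generalized eigenvectors\<close>

lemma cinner_sum_left: "cinner (sum f I) y = (\<Sum>i\<in>I. cinner (f i) (y::'a::complex_inner))"
  by (induction I rule: infinite_finite_induct) (simp_all add: cinner_add_left)

lemma cinner_adjoint_left:
  fixes U :: "'a::finite_dim_hilbert \<Rightarrow> 'a"
  assumes "clinear U"
  shows "cinner (adjoint_op U z) y = cinner z (U y)"
  by (metis adjoint_op_works[OF assms] cinner_commute)

lemma clinear_tuple_power:
  "(\<And>j. j < d \<Longrightarrow> clinear (T j)) \<Longrightarrow> clinear (tuple_power d T \<alpha>)"
proof (induction d)
  case 0
  show ?case by (rule clinearI) simp_all
next
  case (Suc d)
  then have "clinear (tuple_power d T \<alpha>)" "clinear (T d ^^ \<alpha> d)"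
    by (auto intro: clinear_funpow)
  then show ?case
    by (intro clinearI) (simp_all add: clinear_add clinear_scaleC)
qed

text \<open>With \<open>c = (\<Sum>j<d. \<nu> j * cnj (\<mu> j))\<close>, modulo values of the form at vectors with smaller
  exponents the operators \<open>T j\<close> act as the scalars \<open>\<nu> j\<close> and \<open>\<mu> j\<close>, so by the multinomial theorem
  the isometry identity reads \<open>(c - 1) ^ m * \<langle>A x, y\<rangle> = 0\<close>.\<close>

lemma isometric_form_eq_0:
  fixes A :: "'h::finite_dim_hilbert \<Rightarrow> 'h"
  assumes A: "clinear A" and iso: "isometric_tuple A m d T"
    and c: "(\<Sum>j<d. \<nu> j * cnj (\<mu> j)) \<noteq> 1"
    and "x \<in> joint_kernel d T \<nu> e" and "y \<in> joint_kernel d T \<mu> f"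
  shows "cinner (A x) y = 0"
  using assms(4,5)
\<comment> \<open>The measure is the total exponent of both vectors, so lowering one exponent on
  either side gives access to the induction hypothesis.\<close>
proof (induction "\<Sum>j<d. e j + f j" arbitrary: e f x y rule: less_induct)
  case less
  have T: "commuting_tuple d T" using iso by (simp add: isometric_tuple_def)
  show ?case
  proof (cases "\<exists>j<d. e j = 0 \<or> f j = 0")
    case True
    then have "x = 0 \<or> y = 0" using less.prems by (auto simp: joint_kernel_def)
    then show ?thesis using clinear_0[OF A] by auto
  next
    case False
    then have pos: "e j > 0" "f j > 0" if "j < d" for j using that by auto
    have lower: "cinner (A u) v = 0"
      if "u \<in> joint_kernel d T \<nu> e'" "v \<in> joint_kernel d T \<mu> f'" "j < d"
        "\<And>i. e' i + f' i \<le> e i + f i" "e' j + f' j < e j + f j" for u v e' f' j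
      by (rule less.hyps[OF _ that(1,2)], rule sum_strict_mono_ex1) (use that in auto)
    \<comment> \<open>Stated for all vectors of the two kernels, since it is iterated on images of x
      and y, which stay in these kernels.\<close>
    have step: "cinner (A (T j u)) (T j v) = \<nu> j * cnj (\<mu> j) * cinner (A u) v"
      if u: "u \<in> joint_kernel d T \<nu> e" and v: "v \<in> joint_kernel d T \<mu> f" and j: "j < d" for u v j
    proof -
      define u' v' where "u' = T j u - \<nu> j *\<^sub>C u" and "v' = T j v - \<mu> j *\<^sub>C v"
      have u': "u' \<in> joint_kernel d T \<nu> (e(j := e j - 1))"
        unfolding u'_def using T j pos(1)[OF j] u by (rule joint_kernel_shift)
      have v': "v' \<in> joint_kernel d T \<mu> (f(j := f j - 1))"
        unfolding v'_def using T j pos(2)[OF j] v by (rule joint_kernel_shift)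
      \<comment> \<open>Both arguments are split into a scalar part and a shifted part; of the four
        resulting terms the three with a shifted vector vanish by induction.\<close>
      have "cinner (A u') v = 0" "cinner (A u) v' = 0" "cinner (A u') v' = 0"
        by (rule lower[OF u' v j] lower[OF u v' j] lower[OF u' v' j];
            use pos[OF j] in \<open>auto intro: add_mono\<close>)+
      moreover have "T j u = \<nu> j *\<^sub>C u + u'" "T j v = \<mu> j *\<^sub>C v + v'"
        by (simp_all add: u'_def v'_def)
      ultimately show ?thesis
        by (simp add: clinear_add[OF A] clinear_scaleC[OF A] cinner_add_left cinner_add_right
            cinner_scaleC_left cinner_scaleC_right)
    qed
    have power: "cinner (A ((T j ^^ k) u)) ((T j ^^ k) v)
        = (\<nu> j * cnj (\<mu> j)) ^ k * cinner (A u) v"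
      if "u \<in> joint_kernel d T \<nu> e" "v \<in> joint_kernel d T \<mu> f" "j < d" for u v j k
      using joint_kernel_funpow[OF T that(3,1)] joint_kernel_funpow[OF T that(3,2)] that(3)
      by (induction k) (simp_all add: step)
    have tuple: "cinner (A (tuple_power k T \<alpha> u)) (tuple_power k T \<alpha> v)
        = (\<Prod>j<k. (\<nu> j * cnj (\<mu> j)) ^ \<alpha> j) * cinner (A u) v"
      if "u \<in> joint_kernel d T \<nu> e" "v \<in> joint_kernel d T \<mu> f" "k \<le> d" for u v k \<alpha>
      using that
    proof (induction k arbitrary: u v)
      case (Suc k)
      then show ?case
        using joint_kernel_funpow[OF T] by (simp add: power)
    qed simp
    let ?c = "\<Sum>j<d. \<nu> j * cnj (\<mu> j)"
    have summand: "cinner (adjoint_op (tuple_power d T \<alpha>) (A (tuple_power d T \<alpha> x))) y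
        = (\<Prod>j<d. (\<nu> j * cnj (\<mu> j)) ^ \<alpha> j) * cinner (A x) y" for \<alpha>
      using tuple[OF less.prems order_refl]
      by (simp add: cinner_adjoint_left[OF clinear_tuple_power[OF commuting_tuple_linear[OF T]]])
    have "0 = cinner (\<Sum>k\<le>m. ((-1) ^ (m - k) * of_nat (m choose k)) *\<^sub>C
        (\<Sum>\<alpha>\<in>multiindices d k. (fact k / (\<Prod>j<d. fact (\<alpha> j))) *\<^sub>C
          adjoint_op (tuple_power d T \<alpha>) (A (tuple_power d T \<alpha> x)))) y"
      using iso by (simp add: isometric_tuple_def)
    also have "\<dots> = (\<Sum>k\<le>m. (-1) ^ (m - k) * of_nat (m choose k) *
        ((\<Sum>\<alpha>\<in>multiindices d k. fact k / (\<Prod>j<d. fact (\<alpha> j)) *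
          (\<Prod>j<d. (\<nu> j * cnj (\<mu> j)) ^ \<alpha> j)) * cinner (A x) y))"
      by (simp add: cinner_sum_left cinner_scaleC_left summand sum_distrib_right mult.assoc)
    \<comment> \<open>The inner sum is the multinomial expansion of \<open>?c ^ k\<close>; the
      alternating sum over k is then the binomial expansion of \<open>(?c - 1) ^ m\<close>.\<close>
    also have "\<dots> = (\<Sum>k\<le>m. of_nat (m choose k) * ?c ^ k * (-1) ^ (m - k)) * cinner (A x) y"
      unfolding multinomial_theorem by (simp add: sum_distrib_left mult_ac)
    also have "\<dots> = (?c + (-1)) ^ m * cinner (A x) y"
      by (simp only: binomial_ring)
    finally show ?thesis using c by simp
  qed
qed

section \<open>Testing identities on spanning sets\<close>

lemma clinear_eq_on_span:
  assumes "clinear f" and "clinear g" and "cspan B = UNIV" and "\<And>x. x \<in> B \<Longrightarrow> f x = g x"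
  shows "f x = g x"
proof -
  have "x \<in> cspan B" using assms(3) by simp
  then show ?thesis
  proof (induction rule: complex_vector.span_induct)
    case base
    show ?case
      unfolding complex_vector.subspace_def
      using assms(1,2) by (simp add: clinear_0 clinear_add clinear_scaleC)
  qed (rule assms(4))
qed

lemma clinear_adjoint_op:
  fixes U :: "'a::finite_dim_hilbert \<Rightarrow> 'a"
  assumes "clinear U"
  shows "clinear (adjoint_op U)"
  by (rule clinearI; rule cinner_ext_right)
    (simp_all add: adjoint_op_works[OF assms, symmetric] cinner_add_right cinner_scaleC_right)

lemma cinner_ext_span:
  fixes u v :: "'a::complex_inner"
  assumes "cspan B = UNIV" and "\<And>y. y \<in> B \<Longrightarrow> cinner u y = cinner v y"
  shows "u = v"
proof -
  have "cinner (u - v) y = 0" for y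
  proof -
    have "y \<in> cspan B" using assms(1) by simp
    then show ?thesis
    proof (induction rule: complex_vector.span_induct)
      case base
      show ?case
        unfolding complex_vector.subspace_def
        by (simp add: cinner_add_right cinner_scaleC_right)
    qed (simp add: assms(2) cinner_diff_left)
  qed
  from this[of "u - v"] show ?thesis by (simp add: cinner_eq_zero_iff)
qed

section \<open>Nilpotency of commuting tuples\<close>

lemma tuple_power_eq_0:
  assumes "\<And>j. j < d \<Longrightarrow> clinear (T j)" and "i < d" and "\<And>x. (T i ^^ \<alpha> i) x = 0"
  shows "tuple_power d T \<alpha> x = 0"
  using assms
proof (induction d arbitrary: x)
  case (Suc d)
  then show ?case
    using clinear_0[OF clinear_tuple_power, of d T] by (cases "i = d") auto
qed simp

lemma nilpotent_tupleI:
  assumes N: "commuting_tuple d N" and nil: "\<And>j x. j < d \<Longrightarrow> (N j ^^ n j) x = 0"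
  shows "nilpotent_tuple d N"
  unfolding nilpotent_tuple_def
\<comment> \<open>Pigeonhole: once the size of \<open>\<alpha>\<close> exceeds the sum of the
  \<open>n j\<close>, some \<open>\<alpha> i\<close> is at least \<open>n i\<close>.
  \<open>Suc\<close> also keeps the size positive.\<close>
proof (intro conjI N exI[of _ "Suc (sum n {..<d})"] ballI ext)
  fix \<alpha> x assume "\<alpha> \<in> multiindices d (Suc (sum n {..<d}))"
  then have "sum \<alpha> {..<d} = Suc (sum n {..<d})" by (simp add: multiindices_def)
  then have "\<not> sum \<alpha> {..<d} \<le> sum n {..<d}" by simp
  then obtain i where i: "i < d" "n i \<le> \<alpha> i"
    by (meson lessThan_iff nat_le_linear sum_mono)
  show "tuple_power d N \<alpha> x = 0"
    by (rule tuple_power_eq_0[where i = i])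
      (use N i in \<open>auto intro: funpow_eq_0_mono nil commuting_tuple_linear\<close>)
qed simp

section \<open>Assembling S and N from the decompositions of the single operators\<close>

theorem theorem1p1:
  fixes A :: "'h::finite_dim_hilbert \<Rightarrow> 'h"
    and T :: "nat \<Rightarrow> 'h \<Rightarrow> 'h"
    and d m :: nat
  assumes "clinear A"
    and "d \<ge> 1" and "m \<ge> 1"
    and "isometric_tuple A m d T"
  shows "\<exists>S N. spherical_isometric_tuple A d S \<and> nilpotent_tuple d N \<and>
    (\<forall>j<d. \<forall>k<d. S j \<circ> N k = N k \<circ> S j) \<and>
    (\<forall>j<d. T j = (\<lambda>x. S j x + N j x))"
proof -
  have T: "commuting_tuple d T"
    using assms(4) by (simp add: isometric_tuple_def)
  note lin = commuting_tuple_linear[OF T]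
  have "\<forall>j. \<exists>S P \<Lambda> n. j < d \<longrightarrow> jordan_chevalley (T j) S P \<Lambda> n"
    using jordan_chevalley_exists lin by blast
  then obtain S P \<Lambda> n where jc: "\<And>j. j < d \<Longrightarrow> jordan_chevalley (T j) (S j) (P j) (\<Lambda> j) (n j)"
    by metis
  have S: "clinear (S j)" if "j < d" for j
    using jc[OF that] by (simp add: jordan_chevalley_def)
  \<comment> \<open>The commutant is used twice: \<open>T i\<close> commutes with
    \<open>T j\<close>, hence with \<open>S j\<close>; so \<open>S j\<close> commutes with
    \<open>T i\<close>, hence with \<open>S i\<close>.\<close>
  have S_commute: "U (S j x) = S j (U x)"
    if "j < d" "clinear U" "\<And>x. U (T j x) = T j (U x)" for U j x
    using jc[OF that(1)] that(2,3) by (simp add: jordan_chevalley_def)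
  have TS: "T i (S j x) = S j (T i x)" if "i < d" "j < d" for i j x
    using that by (intro S_commute lin commuting_tuple_commute[OF T])
  have SS: "S i (S j x) = S j (S i x)" if "i < d" "j < d" for i j x
    using that TS by (intro S_commute S) simp_all
  define N where "N j x = T j x - S j x" for j x
  have N: "clinear (N j)" if "j < d" for j
    unfolding N_def using lin[OF that] S[OF that]
    by (intro clinearI)
      (simp_all add: clinear_add clinear_scaleC complex_vector.scale_right_diff_distrib)
  have SN: "S i (N j x) = N j (S i x)" if "i < d" "j < d" for i j x
    using that by (simp add: N_def clinear_diff[OF S] TS SS)
  have NN: "N i (N j x) = N j (N i x)" if "i < d" "j < d" for i j x
    using that SN[of i j x] SN[of j i x]
    by (simp add: N_def clinear_diff[OF S] clinear_diff[OF lin] TS SS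
        commuting_tuple_commute[OF T, of i j] algebra_simps)
  define B where "B = (\<Union>\<nu>\<in>{\<nu>. \<forall>j<d. \<nu> j \<in> \<Lambda> j}. joint_kernel d T \<nu> n)"
  have span_B: "cspan B = UNIV"
    unfolding B_def using T jc by (rule joint_kernel_span) simp_all
  have eigen: "S j x = \<nu> j *\<^sub>C x"
    if "\<forall>j<d. \<nu> j \<in> \<Lambda> j" "x \<in> joint_kernel d T \<nu> n" "j < d" for \<nu> x j
    using that jc[OF that(3)] by (simp add: jordan_chevalley_def joint_kernel_def)
  \<comment> \<open>Both sides are linear in x, and a vector is determined by its inner products
    with a spanning set, so x and y may be taken to be joint generalized eigenvectors, on which
    every \<open>S j\<close> acts as a scalar.\<close>
  have form: "(\<Sum>j<d. adjoint_op (S j) (A (S j x))) = A x" for x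
  proof (rule clinear_eq_on_span[OF _ assms(1) span_B])
    show "clinear (\<lambda>x. \<Sum>j<d. adjoint_op (S j) (A (S j x)))"
      using assms(1) S clinear_adjoint_op[OF S]
      by (intro clinear_sum_fun clinearI) (simp_all add: clinear_add clinear_scaleC)
    fix x assume "x \<in> B"
    then obtain \<nu> where \<nu>: "\<forall>j<d. \<nu> j \<in> \<Lambda> j" "x \<in> joint_kernel d T \<nu> n"
      by (auto simp: B_def)
    show "(\<Sum>j<d. adjoint_op (S j) (A (S j x))) = A x"
    proof (rule cinner_ext_span[OF span_B])
      fix y assume "y \<in> B"
      then obtain \<mu> where \<mu>: "\<forall>j<d. \<mu> j \<in> \<Lambda> j" "y \<in> joint_kernel d T \<mu> n"
        by (auto simp: B_def)
      have "cinner (\<Sum>j<d. adjoint_op (S j) (A (S j x))) y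
          = (\<Sum>j<d. \<nu> j * cnj (\<mu> j)) * cinner (A x) y"
        by (simp add: cinner_sum_left cinner_adjoint_left[OF S] eigen[OF \<nu>] eigen[OF \<mu>]
            clinear_scaleC[OF assms(1)] cinner_scaleC_left cinner_scaleC_right sum_distrib_left
            mult_ac)
      \<comment> \<open>Either the scalar factor is 1, or the form vanishes at x and y.\<close>
      also have "\<dots> = cinner (A x) y"
        using isometric_form_eq_0[OF assms(1,4) _ \<nu>(2) \<mu>(2)] by fastforce
      finally show "cinner (\<Sum>j<d. adjoint_op (S j) (A (S j x))) y = cinner (A x) y" .
    qed
  qed
  have "commuting_tuple d S"
    using S SS by (simp add: commuting_tuple_def fun_eq_iff)
  then have "spherical_isometric_tuple A d S"
    using form by (simp add: spherical_isometric_tuple_iff)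
  moreover have "commuting_tuple d N"
    using N NN by (simp add: commuting_tuple_def fun_eq_iff)
  then have "nilpotent_tuple d N"
  proof (rule nilpotent_tupleI)
    show "(N j ^^ n j) x = 0" if "j < d" for j x
      using jc[OF that] unfolding jordan_chevalley_def N_def[abs_def] by blast
  qed
  moreover have "\<forall>j<d. \<forall>k<d. S j \<circ> N k = N k \<circ> S j"
    using SN by (simp add: fun_eq_iff)
  moreover have "\<forall>j<d. T j = (\<lambda>x. S j x + N j x)"
    by (simp add: N_def fun_eq_iff)
  ultimately show ?thesis by blast
qed

end
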